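(* For a permutation $\pi_n$ of $[n]=\{1,\dots,n\}$ and $1\le k\le n$, say that $\pi_n$ consecutively contains a permutation $\mu=(\mu_1,\dots,\mu_k)$ of $[k]$ if there is an index $m$ with $1\le m\le n-k+1$ such that $(\pi_n(m),\pi_n(m+1),\dots,\pi_n(m+k-1))$ is in the same relative order as $(\mu_1,\dots,\mu_k)$. Let $\phi(\pi_n)$ be the number of distinct permutations $\mu$, of all lengths $k$ with $1\le k\le n$, that are consecutively contained in $\pi_n$. Let $\pi_n$ be a uniformly random permutation of $[n]$ and $X=\phi(\pi_n)$. Then, as $n\to\infty$, \[\mathbb{E}(X)=\Big(\max_{\sigma\in S_n}\phi(\sigma)\Big)(1-o(1))=\frac{n^2}{2}(1-o(1)),\] that is, $\mathbb{E}(X)\big/\max_{\sigma\in S_n}\phi(\sigma)\to 1$ and $\mathbb{E}(X)\big/(n^2/2)\to 1$.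
   Context: $S_n$ denotes the set of permutations of $[n]$. Two sequences of distinct numbers of the same length are in the same relative order (order isomorphic) if for all $i,j$, the $i$th entry is smaller than the $j$th entry in one sequence iff the same holds in the other. *)

theory Defs
  imports "HOL-Probability.Probability" "HOL-Combinatorics.Permutations"
begin

definition same_relative_order :: "nat list \<Rightarrow> nat list \<Rightarrow> bool" where
  "same_relative_order xs ys \<longleftrightarrow>
     length xs = length ys \<and>
     (\<forall>i<length xs. \<forall>j<length xs. xs ! i < xs ! j \<longleftrightarrow> ys ! i < ys ! j)"

definition perms :: "nat \<Rightarrow> (nat \<Rightarrow> nat) set" where
  "perms n = {\<pi>. \<pi> permutes {1..n}}"

text \<open>
  Intended for \<open>1 \<le> k \<le> n\<close>, \<open>\<pi> \<in> perms n\<close> and \<open>\<mu> \<in> perms k\<close>.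
  The lists are \<open>(\<pi>(m), \<dots>, \<pi>(m + k - 1))\<close> and \<open>(\<mu>(1), \<dots>, \<mu>(k))\<close>.
\<close>

definition consecutively_contains ::
    "nat \<Rightarrow> (nat \<Rightarrow> nat) \<Rightarrow> nat \<Rightarrow> (nat \<Rightarrow> nat) \<Rightarrow> bool" where
  "consecutively_contains n \<pi> k \<mu> \<longleftrightarrow>
     (\<exists>m. 1 \<le> m \<and> m \<le> n - k + 1 \<and>
          same_relative_order (map \<pi> [m..<m + k]) (map \<mu> [1..<k + 1]))"

text \<open>
  The length \<open>k\<close> is recorded along with the pattern, because a function that
  permutes \<open>{1..k}\<close> also permutes \<open>{1..k + 1}\<close>, whereas patterns of different
  lengths are distinct.
\<close>

definition phi :: "nat \<Rightarrow> (nat \<Rightarrow> nat) \<Rightarrow> nat" where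
  "phi n \<pi> = card {(k, \<mu>). 1 \<le> k \<and> k \<le> n \<and> \<mu> \<in> perms k \<and>
                             consecutively_contains n \<pi> k \<mu>}"

definition max_phi :: "nat \<Rightarrow> nat" where
  "max_phi n = Max (phi n ` perms n)"

definition expected_phi :: "nat \<Rightarrow> real" where
  "expected_phi n = measure_pmf.expectation (pmf_of_set (perms n)) (\<lambda>\<pi>. real (phi n \<pi>))"

end

(*
  There are at most n - k + 1 windows of length k, so phi <= n(n+1)/2. Conversely, if no two
  windows of length K are in the same relative order, then no two longer windows of equal length
  are, and phi >= (n - K)^2/2. Take K = s^2 with s about n^(1/4). If the windows of length K at m
  and m + d agree and d >= s, then two disjoint windows of length s agree; if d < s, then the
  values at m, m + d, ..., m + (s - 1)d are monotone. Such coincidences have probability at most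
  1/s! and 2/s! respectively, so a random permutation has one with probability at most
  2 n^2/s! = o(1).
*)

theory Submission
  imports Defs "HOL-Real_Asymp.Real_Asymp"
begin

section \<open>Counting permutations whose order on a block is forced\<close>

text \<open>An element of a finite linearly ordered set is determined by its rank. The rank of
  \<open>f x\<close> in the common image is the number of points of \<open>B\<close> with smaller
  \<open>f\<close>-value, and \<open>g\<close> gives the same number.\<close>

lemma order_isomorphic_enumerations_eq:
  fixes f g :: "'a \<Rightarrow> 'b::linorder"
  assumes "finite B" "inj_on f B" "inj_on g B" "f ` B = g ` B"
    and ord: "\<And>x y. x \<in> B \<Longrightarrow> y \<in> B \<Longrightarrow> f x < f y \<longleftrightarrow> g x < g y"
    and "x \<in> B"
  shows "f x = g x"
proof (rule ccontr)
  assume ne: "f x \<noteq> g x"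
  have rank: "card {z \<in> h ` B. z < h x} = card {y \<in> B. h y < h x}"
    if "inj_on h B" for h :: "'a \<Rightarrow> 'b"
  proof -
    have "{z \<in> h ` B. z < h x} = h ` {y \<in> B. h y < h x}" by auto
    moreover have "inj_on h {y \<in> B. h y < h x}" by (rule inj_on_subset[OF that]) auto
    ultimately show ?thesis by (simp add: card_image)
  qed
  have "{y \<in> B. f y < f x} = {y \<in> B. g y < g x}" using ord \<open>x \<in> B\<close> by auto
  then have eq: "card {z \<in> g ` B. z < f x} = card {z \<in> g ` B. z < g x}"
    using rank[OF assms(2)] rank[OF assms(3)] assms(4) by simp
  have fin: "finite {z \<in> g ` B. z < c}" for c using \<open>finite B\<close> by simp
  have mem: "f x \<in> g ` B" "g x \<in> g ` B" using assms(4) \<open>x \<in> B\<close> by auto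
  consider "f x < g x" | "g x < f x" using ne by (meson linorder_neqE)
  then show False
  proof cases
    case 1
    then have "{z \<in> g ` B. z < f x} \<subset> {z \<in> g ` B. z < g x}" using mem by force
    from psubset_card_mono[OF fin this] eq show False by simp
  next
    case 2
    then have "{z \<in> g ` B. z < g x} \<subset> {z \<in> g ` B. z < f x}" using mem by force
    from psubset_card_mono[OF fin this] eq show False by simp
  qed
qed

lemma finite_perms [simp]: "finite (perms n)"
  by (simp add: perms_def finite_permutations)

lemma card_perms: "card (perms n) = fact n"
  by (simp add: perms_def card_permutations)

lemma id_in_perms: "id \<in> perms n"
  by (simp add: perms_def permutes_id)

text \<open>
  Rearranging the values on \<open>B\<close> in all possible ways turns each member of \<open>A\<close> into
  \<open>(card B)!\<close> permutations, and no permutation arises twice.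
\<close>

lemma card_determined_order_le:
  assumes A: "A \<subseteq> perms n" and B: "B \<subseteq> {1..n}"
    and det: "\<And>\<pi> \<pi>' x y. \<pi> \<in> A \<Longrightarrow> \<pi>' \<in> A \<Longrightarrow> (\<And>z. z \<notin> B \<Longrightarrow> \<pi> z = \<pi>' z) \<Longrightarrow>
               x \<in> B \<Longrightarrow> y \<in> B \<Longrightarrow> \<pi> x < \<pi> y \<longleftrightarrow> \<pi>' x < \<pi>' y"
  shows "card A * fact (card B) \<le> fact n"
proof -
  define S where "S = {\<sigma>. \<sigma> permutes B}"
  have finB: "finite B" using B finite_subset by blast
  have perm: "\<pi> permutes {1..n}" if "\<pi> \<in> A" for \<pi> using A that by (auto simp: perms_def)
  \<comment> \<open>Since \<open>\<sigma>\<close> moves only points of \<open>B\<close>, the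
    composite still shows the values of \<open>\<pi>\<close> off \<open>B\<close> and the set of its
    values on \<open>B\<close>. By \<open>det\<close> the order on \<open>B\<close> is then known as
    well, which recovers \<open>\<pi>\<close>; cancelling it recovers
    \<open>\<sigma>\<close>.\<close>
  have inj: "inj_on (\<lambda>(\<pi>, \<sigma>). \<pi> \<circ> \<sigma>) (A \<times> S)"
  proof (rule inj_onI, clarify)
    fix \<pi> \<sigma> \<pi>' \<sigma>'
    assume a: "\<pi> \<in> A" "\<sigma> \<in> S" "\<pi>' \<in> A" "\<sigma>' \<in> S" and eq: "\<pi> \<circ> \<sigma> = \<pi>' \<circ> \<sigma>'"
    have s: "\<sigma> permutes B" "\<sigma>' permutes B" using a by (auto simp: S_def)
    have out: "\<pi> z = \<pi>' z" if "z \<notin> B" for z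
      using fun_cong[OF eq, of z] s that by (simp add: permutes_not_in)
    have "(\<pi> \<circ> \<sigma>) ` B = (\<pi>' \<circ> \<sigma>') ` B" using eq by simp
    then have img: "\<pi> ` B = \<pi>' ` B" using s by (metis image_comp permutes_image)
    have "\<pi> z = \<pi>' z" if "z \<in> B" for z
    proof (rule order_isomorphic_enumerations_eq[OF finB _ _ img _ that])
      show "inj_on \<pi> B" "inj_on \<pi>' B"
        using perm[OF a(1)] perm[OF a(3)] by (auto intro: permutes_inj_on)
      show "\<pi> x < \<pi> y \<longleftrightarrow> \<pi>' x < \<pi>' y" if "x \<in> B" "y \<in> B" for x y
        using det[OF a(1,3) out that] .
    qed
    with out have pi: "\<pi> = \<pi>'" by blast
    have "inj \<pi>" using perm[OF a(1)] by (rule permutes_inj)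
    moreover have "\<pi> \<circ> \<sigma> = \<pi> \<circ> \<sigma>'" using eq pi by simp
    ultimately have "\<sigma> = \<sigma>'" by (auto simp: fun_eq_iff dest: injD)
    with pi show "\<pi> = \<pi>' \<and> \<sigma> = \<sigma>'" by simp
  qed
  have sub: "(\<lambda>(\<pi>, \<sigma>). \<pi> \<circ> \<sigma>) ` (A \<times> S) \<subseteq> perms n"
  proof clarify
    fix \<pi> \<sigma> assume "\<pi> \<in> A" "\<sigma> \<in> S"
    then have "\<pi> permutes {1..n}" "\<sigma> permutes {1..n}"
      using perm permutes_subset[OF _ B] by (auto simp: S_def)
    then show "\<pi> \<circ> \<sigma> \<in> perms n" by (simp add: perms_def permutes_compose)
  qed
  have "card (A \<times> S) \<le> card (perms n)"
    using card_inj_on_le[OF inj sub] by simp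
  then show ?thesis
    using finB by (simp add: card_cartesian_product card_perms S_def card_permutations)
qed

section \<open>Coincidences between two windows and their frequency\<close>

text \<open>Stated by offsets from the two starting positions rather than by lists, so that
  shortening both windows only restricts the quantifiers.\<close>

definition windows_agree :: "(nat \<Rightarrow> nat) \<Rightarrow> nat \<Rightarrow> nat \<Rightarrow> nat \<Rightarrow> bool" where
  "windows_agree \<pi> k m m' \<longleftrightarrow>
     (\<forall>i<k. \<forall>j<k. \<pi> (m + i) < \<pi> (m + j) \<longleftrightarrow> \<pi> (m' + i) < \<pi> (m' + j))"

lemma windows_agree_mono: "windows_agree \<pi> K m m' \<Longrightarrow> k \<le> K \<Longrightarrow> windows_agree \<pi> k m m'"
  unfolding windows_agree_def by (meson less_le_trans)

text \<open>Because \<open>s \<le> d\<close>, the left window lies outside the right one. Its values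
  are untouched when the right window is rearranged, and they prescribe the order there.\<close>

lemma card_disjoint_windows_agree_le:
  assumes "1 \<le> m" "s \<le> d" "m + d + s \<le> n + 1"
  shows "card {\<pi> \<in> perms n. windows_agree \<pi> s m (m + d)} * fact s \<le> fact n"
proof -
  let ?B = "{m + d..<m + d + s}"
  have "card {\<pi> \<in> perms n. windows_agree \<pi> s m (m + d)} * fact (card ?B) \<le> fact n"
  proof (rule card_determined_order_le)
    fix \<pi> \<pi>' x y
    assume a: "\<pi> \<in> {\<pi> \<in> perms n. windows_agree \<pi> s m (m + d)}"
      "\<pi>' \<in> {\<pi> \<in> perms n. windows_agree \<pi> s m (m + d)}"
      and out: "\<And>z. z \<notin> ?B \<Longrightarrow> \<pi> z = \<pi>' z" and "x \<in> ?B" "y \<in> ?B"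
    then obtain i j where ij: "x = m + d + i" "y = m + d + j" "i < s" "j < s"
      by (metis atLeastLessThan_iff le_Suc_ex nat_add_left_cancel_less)
    have "\<pi> (m + i) = \<pi>' (m + i)" "\<pi> (m + j) = \<pi>' (m + j)"
      using ij assms by (auto intro!: out)
    then show "\<pi> x < \<pi> y \<longleftrightarrow> \<pi>' x < \<pi>' y"
      using a ij unfolding windows_agree_def by fastforce
  qed (use assms in auto)
  then show ?thesis by simp
qed

text \<open>Agreement at shift \<open>d\<close> makes the values along
  \<open>m, m + d, ..., m + (s - 1) * d\<close> monotone. Increasing and decreasing progressions
  each prescribe the order of \<open>s\<close> values, hence the factor 2.\<close>

lemma card_overlapping_windows_agree_le:
  assumes "1 \<le> m" "1 \<le> d" "d < s" "m + d + s * s \<le> n + 1"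
  shows "card {\<pi> \<in> perms n. windows_agree \<pi> (s * s) m (m + d)} * fact s \<le> 2 * fact n"
proof -
  let ?M = "{\<pi> \<in> perms n. windows_agree \<pi> (s * s) m (m + d)}"
  define B where "B = (\<lambda>t. m + t * d) ` {..<s}"
  have cB: "card B = s"
    unfolding B_def using assms(2) by (subst card_image) (auto simp: inj_on_def)
  \<comment> \<open>This is why the window length is \<open>s * s\<close>: with
    \<open>d < s\<close>, all \<open>s\<close> terms of the progression fall into the first
    window.\<close>
  have td: "t * d < s * s" if "t < s" for t
    using that assms(2,3) by (intro mult_strict_mono) auto
  have BS: "B \<subseteq> {1..n}"
  proof
    fix x assume "x \<in> B"
    then obtain t where t: "x = m + t * d" "t < s" by (auto simp: B_def)
    then show "x \<in> {1..n}" using td[of t] assms by auto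
  qed
  text \<open>Agreement at shift \<open>d\<close> propagates each comparison one step along the progression.\<close>
  have step: "\<pi> (m + t * d) < \<pi> (m + Suc t * d) \<longleftrightarrow> \<pi> m < \<pi> (m + d)"
    if "\<pi> \<in> ?M" "Suc t < s" for \<pi> t
    using that(2)
  proof (induction t)
    case (Suc t)
    have "\<pi> (m + t * d) < \<pi> (m + Suc t * d) \<longleftrightarrow>
          \<pi> (m + d + t * d) < \<pi> (m + d + Suc t * d)"
      using that(1) td[of t] td[of "Suc t"] Suc.prems unfolding windows_agree_def
      by (metis (mono_tags, lifting) Suc_lessD mem_Collect_eq)
    with Suc show ?case by (simp add: algebra_simps)
  qed simp
  have inj: "\<pi> x = \<pi> y \<longleftrightarrow> x = y" if "\<pi> \<in> ?M" for \<pi> x y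
    using that by (auto simp: perms_def dest: permutes_inj injD)
  have up: "\<pi> (m + t * d) < \<pi> (m + u * d)"
    if "\<pi> \<in> ?M" "\<pi> m < \<pi> (m + d)" "t < u" "u < s" for \<pi> t u
    using that(3,4)
  proof (induction u)
    case (Suc u)
    have "\<pi> (m + u * d) < \<pi> (m + Suc u * d)" using step[OF that(1)] that(2) Suc.prems by blast
    moreover have "\<pi> (m + t * d) \<le> \<pi> (m + u * d)"
      using Suc by (cases "t = u") auto
    ultimately show ?case by simp
  qed simp
  have down: "\<pi> (m + t * d) > \<pi> (m + u * d)"
    if "\<pi> \<in> ?M" "\<not> \<pi> m < \<pi> (m + d)" "t < u" "u < s" for \<pi> t u
    using that(3,4)
  proof (induction u)
    case (Suc u)
    have "\<not> \<pi> (m + u * d) < \<pi> (m + Suc u * d)" using step[OF that(1)] that(2) Suc.prems by blast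
    \<comment> \<open>The absence of an ascent gives only a weak inequality; injectivity makes it
      strict.\<close>
    moreover have "\<pi> (m + u * d) \<noteq> \<pi> (m + Suc u * d)"
      using inj[OF that(1)] assms(2) by simp
    moreover have "\<pi> (m + t * d) \<ge> \<pi> (m + u * d)"
      using Suc by (cases "t = u") auto
    ultimately show ?case by simp
  qed simp
  \<comment> \<open>The first comparison decides the direction. Within each class the order on
    \<open>B\<close> is the same for all permutations, as the counting lemma demands.\<close>
  define Up where "Up = {\<pi> \<in> ?M. \<pi> m < \<pi> (m + d)}"
  define Dn where "Dn = {\<pi> \<in> ?M. \<not> \<pi> m < \<pi> (m + d)}"
  have upB: "\<pi> (m + t * d) < \<pi> (m + u * d) \<longleftrightarrow> t < u"
    if "\<pi> \<in> Up" "t < s" "u < s" for \<pi> t u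
    using up[of \<pi> t u] up[of \<pi> u t] that by (cases t u rule: linorder_cases) (auto simp: Up_def)
  have downB: "\<pi> (m + t * d) < \<pi> (m + u * d) \<longleftrightarrow> u < t"
    if "\<pi> \<in> Dn" "t < s" "u < s" for \<pi> t u
    using down[of \<pi> t u] down[of \<pi> u t] that by (cases t u rule: linorder_cases) (auto simp: Dn_def)
  have "card Up * fact (card B) \<le> fact n"
    by (rule card_determined_order_le[OF _ BS]) (auto simp: B_def upB, auto simp: Up_def)
  moreover have "card Dn * fact (card B) \<le> fact n"
    by (rule card_determined_order_le[OF _ BS]) (auto simp: B_def downB, auto simp: Dn_def)
  moreover have "card ?M \<le> card Up + card Dn"
  proof -
    have "?M = Up \<union> Dn" by (auto simp: Up_def Dn_def)
    then show ?thesis by (metis card_Un_le)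
  qed
  ultimately show ?thesis
    using mult_right_mono[of "card ?M" "card Up + card Dn" "fact s :: nat"] cB
    by (simp add: algebra_simps)
qed

text \<open>The exceptional permutations. The later window ends at \<open>m' + K - 1\<close>, so the
  bound \<open>n + 1\<close> keeps both windows inside \<open>{1..n}\<close>.\<close>

definition repetitive_perms :: "nat \<Rightarrow> nat \<Rightarrow> (nat \<Rightarrow> nat) set" where
  "repetitive_perms n K = {\<pi> \<in> perms n. \<exists>m m'. 1 \<le> m \<and> m < m' \<and> m' + K \<le> n + 1 \<and>
                                          windows_agree \<pi> K m m'}"

text \<open>A union bound over at most \<open>n * n\<close> pairs of a start and a shift, where
  \<open>2 * fact n\<close> covers both small and large shifts.\<close>

lemma card_repetitive_perms_le:
  assumes "1 \<le> s"
  shows "card (repetitive_perms n (s * s)) * fact s \<le> n * n * (2 * fact n)"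
proof -
  define P where "P = {(m, d). 1 \<le> m \<and> 1 \<le> d \<and> m + d + s * s \<le> n + 1}"
  define M where "M = (\<lambda>(m, d). {\<pi> \<in> perms n. windows_agree \<pi> (s * s) m (m + d)})"
  have Psub: "P \<subseteq> {1..n} \<times> {1..n}" using assms by (auto simp: P_def)
  then have finP: "finite P" by (rule finite_subset) auto
  have cP: "card P \<le> n * n" using card_mono[OF _ Psub] by (simp add: card_cartesian_product)
  have "repetitive_perms n (s * s) \<subseteq> (\<Union>p\<in>P. M p)"
  proof
    fix \<pi> assume "\<pi> \<in> repetitive_perms n (s * s)"
    then obtain m m' where h: "\<pi> \<in> perms n" "1 \<le> m" "m < m'" "m' + s * s \<le> n + 1"
      "windows_agree \<pi> (s * s) m m'" by (auto simp: repetitive_perms_def)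
    then have "(m, m' - m) \<in> P" "\<pi> \<in> M (m, m' - m)" by (auto simp: P_def M_def)
    then show "\<pi> \<in> (\<Union>p\<in>P. M p)" by blast
  qed
  then have "card (repetitive_perms n (s * s)) \<le> card (\<Union>p\<in>P. M p)"
    using finP by (intro card_mono) (auto simp: M_def)
  also have "\<dots> \<le> (\<Sum>p\<in>P. card (M p))" by (rule card_UN_le[OF finP])
  finally have "card (repetitive_perms n (s * s)) * fact s \<le> (\<Sum>p\<in>P. card (M p)) * fact s"
    by simp
  also have "\<dots> = (\<Sum>p\<in>P. card (M p) * fact s)" by (simp add: sum_distrib_right)
  also have "\<dots> \<le> (\<Sum>p\<in>P. 2 * fact n)"
  proof (rule sum_mono, clarify)
    fix m d assume "(m, d) \<in> P"
    then have p: "1 \<le> m" "1 \<le> d" "m + d + s * s \<le> n + 1" by (auto simp: P_def)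
    have ss: "s \<le> s * s" using assms by simp
    show "card (M (m, d)) * fact s \<le> 2 * fact n"
    proof (cases "d < s")
      case True
      then show ?thesis using card_overlapping_windows_agree_le[of m d s n] p by (simp add: M_def)
    next
      case False
      \<comment> \<open>The full windows may overlap, but their initial segments of length
        \<open>s\<close> are disjoint because \<open>s \<le> d\<close>.\<close>
      have "card (M (m, d)) \<le> card {\<pi> \<in> perms n. windows_agree \<pi> s m (m + d)}"
        using windows_agree_mono[OF _ ss] by (intro card_mono) (auto simp: M_def)
      then have "card (M (m, d)) * fact s \<le>
          card {\<pi> \<in> perms n. windows_agree \<pi> s m (m + d)} * fact s" by simp
      also have "\<dots> \<le> fact n"
        using card_disjoint_windows_agree_le[of m s d n] p ss False by simp
      finally show ?thesis by simp
    qed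
  qed
  also have "\<dots> = card P * (2 * fact n)" by simp
  also have "\<dots> \<le> n * n * (2 * fact n)" using cP by (rule mult_right_mono) simp
  finally show ?thesis .
qed

section \<open>Windows and their patterns\<close>

lemma same_relative_order_window_iff:
  "same_relative_order (map \<pi> [m..<m + k]) (map \<mu> [1..<k + 1]) \<longleftrightarrow>
     (\<forall>i<k. \<forall>j<k. \<pi> (m + i) < \<pi> (m + j) \<longleftrightarrow> \<mu> (1 + i) < \<mu> (1 + j))"
  by (simp add: same_relative_order_def del: upt_Suc)

text \<open>Both permutations enumerate \<open>{1..k}\<close> in the order given by
  \<open>xs\<close>, so they agree there; elsewhere both are the identity.\<close>

lemma same_relative_order_perms_unique:
  assumes "\<mu> \<in> perms k" "\<nu> \<in> perms k"
    and "same_relative_order xs (map \<mu> [1..<k + 1])" "same_relative_order xs (map \<nu> [1..<k + 1])"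
  shows "\<mu> = \<nu>"
proof
  have p: "\<mu> permutes {1..k}" "\<nu> permutes {1..k}" using assms by (auto simp: perms_def)
  have ord: "\<mu> (1 + i) < \<mu> (1 + j) \<longleftrightarrow> \<nu> (1 + i) < \<nu> (1 + j)" if "i < k" "j < k" for i j
    using assms(3,4) that by (simp add: same_relative_order_def del: upt_Suc)
  have ord': "\<mu> x < \<mu> y \<longleftrightarrow> \<nu> x < \<nu> y" if "x \<in> {1..k}" "y \<in> {1..k}" for x y
    using ord[of "x - 1" "y - 1"] that by auto
  fix x show "\<mu> x = \<nu> x"
  proof (cases "x \<in> {1..k}")
    case True
    show ?thesis
      by (rule order_isomorphic_enumerations_eq[OF _ _ _ _ ord' True])
         (use p in \<open>auto simp: permutes_image intro: permutes_inj_on\<close>)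
  qed (use p in \<open>simp add: permutes_not_in\<close>)
qed

text \<open>Standardization: each position is sent to the rank of its value within the
  window.\<close>

lemma exists_pattern_of_window:
  assumes "inj \<pi>"
  shows "\<exists>\<mu>\<in>perms k. same_relative_order (map \<pi> [m..<m + k]) (map \<mu> [1..<k + 1])"
proof -
  define f where "f i = \<pi> (m + (i - 1))" for i
  define R where "R i = {j \<in> {1..k}. f j \<le> f i}" for i
  \<comment> \<open>Counting with \<open>\<le>\<close> in \<open>R\<close> makes the ranks start at
    1, and fixing all other points is what \<open>permutes\<close> requires.\<close>
  define \<mu> where "\<mu> i = (if i \<in> {1..k} then card (R i) else i)" for i
  have finR: "finite (R i)" for i by (simp add: R_def)
  have f_eq: "f i = f j \<longleftrightarrow> i = j" if "i \<in> {1..k}" "j \<in> {1..k}" for i j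
    using inj_eq[OF assms] that by (auto simp: f_def)
  have mono: "\<mu> i < \<mu> j" if "f i < f j" "i \<in> {1..k}" "j \<in> {1..k}" for i j
  proof -
    have "R i \<subseteq> R j" "j \<in> R j" "j \<notin> R i" using that by (auto simp: R_def)
    then have "R i \<subset> R j" by blast
    then have "card (R i) < card (R j)" by (rule psubset_card_mono[OF finR])
    with that show ?thesis by (simp add: \<mu>_def)
  qed
  have iff: "f i < f j \<longleftrightarrow> \<mu> i < \<mu> j" if "i \<in> {1..k}" "j \<in> {1..k}" for i j
    using mono[of i j] mono[of j i] f_eq[of i j] that
    by (cases "f i" "f j" rule: linorder_cases) auto
  have "\<mu> ` {1..k} \<subseteq> {1..k}"
  proof clarify
    fix i assume i: "i \<in> {1..k}"
    then have "i \<in> R i" by (simp add: R_def)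
    then have "card (R i) > 0" using finR card_gt_0_iff by blast
    moreover have "card (R i) \<le> card {1..k}" by (rule card_mono) (auto simp: R_def)
    ultimately show "\<mu> i \<in> {1..k}" using i by (simp add: \<mu>_def)
  qed
  moreover have inj: "inj_on \<mu> {1..k}"
    using iff f_eq by (metis inj_onI nat_neq_iff)
  ultimately have "bij_betw \<mu> {1..k} {1..k}"
    by (simp add: bij_betw_def endo_inj_surj)
  then have "\<mu> permutes {1..k}" by (rule bij_imp_permutes) (auto simp: \<mu>_def)
  moreover have "\<pi> (m + i) < \<pi> (m + j) \<longleftrightarrow> \<mu> (1 + i) < \<mu> (1 + j)" if "i < k" "j < k" for i j
    using iff[of "1 + i" "1 + j"] that by (simp add: f_def)
  ultimately show ?thesis
    unfolding perms_def same_relative_order_window_iff by blast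
qed

text \<open>For injective \<open>\<pi>\<close> exactly one permutation qualifies, so the choice is
  the standardization of the window.\<close>

definition window_pattern :: "(nat \<Rightarrow> nat) \<Rightarrow> nat \<Rightarrow> nat \<Rightarrow> nat \<Rightarrow> nat" where
  "window_pattern \<pi> k m = (SOME \<mu>. \<mu> \<in> perms k \<and>
     same_relative_order (map \<pi> [m..<m + k]) (map \<mu> [1..<k + 1]))"

lemma window_pattern:
  assumes "inj \<pi>"
  shows "window_pattern \<pi> k m \<in> perms k"
    and "same_relative_order (map \<pi> [m..<m + k]) (map (window_pattern \<pi> k m) [1..<k + 1])"
  using someI_ex[OF exists_pattern_of_window[OF assms, of k m, unfolded Bex_def]]
  unfolding window_pattern_def by blast+

text \<open>With \<open>phi\<close> written as the size of an image of the set of windows, upper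
  bounds come from counting windows and lower bounds from injectivity on a subset of them.\<close>

lemma phi_eq_card_window_patterns:
  assumes "inj \<pi>"
  shows "phi n \<pi> = card ((\<lambda>(k, m). (k, window_pattern \<pi> k m)) ` (SIGMA k:{1..n}. {1..n - k + 1}))"
proof -
  have "{(k, \<mu>). 1 \<le> k \<and> k \<le> n \<and> \<mu> \<in> perms k \<and> consecutively_contains n \<pi> k \<mu>} =
        (\<lambda>(k, m). (k, window_pattern \<pi> k m)) ` (SIGMA k:{1..n}. {1..n - k + 1})" (is "?L = ?R")
  proof (intro set_eqI iffI)
    fix x assume "x \<in> ?L"
    then obtain k \<mu> m where x: "x = (k, \<mu>)" "1 \<le> k" "k \<le> n" "\<mu> \<in> perms k"
      "1 \<le> m" "m \<le> n - k + 1" "same_relative_order (map \<pi> [m..<m + k]) (map \<mu> [1..<k + 1])"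
      by (auto simp: consecutively_contains_def)
    have "\<mu> = window_pattern \<pi> k m"
      by (rule same_relative_order_perms_unique[OF x(4) window_pattern(1)[OF assms]
            x(7) window_pattern(2)[OF assms]])
    then show "x \<in> ?R" using x by (auto intro!: image_eqI[of _ _ "(k, m)"])
  next
    fix x assume "x \<in> ?R"
    then obtain k m where "x = (k, window_pattern \<pi> k m)" "1 \<le> k" "k \<le> n" "1 \<le> m" "m \<le> n - k + 1"
      by auto
    then show "x \<in> ?L"
      using window_pattern[OF assms, where k = k and m = m]
      unfolding consecutively_contains_def by blast
  qed
  then show ?thesis by (simp add: phi_def)
qed

section \<open>Bounds on \<open>phi\<close>\<close>

text \<open>There are \<open>n - k + 1\<close> starts for length \<open>k\<close>, so the count is
  the triangular number \<open>1 + ... + (n - K + 1)\<close>; doubling avoids division on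
  naturals.\<close>

lemma card_windows:
  assumes "K \<le> n"
  shows "2 * card (SIGMA k:{K..n}. {1..n - k + 1}) = (n - K + 1) * (n - K + 2)"
proof -
  have "card (SIGMA k:{K..n}. {1..n - k + 1}) = (\<Sum>k\<in>{K..n}. n - k + 1)" by simp
  also have "\<dots> = (\<Sum>j\<in>{..n - K}. j + 1)"
    by (rule sum.reindex_bij_witness[of _ "\<lambda>j. n - j" "\<lambda>k. n - k"]) (use assms in auto)
  finally have "card (SIGMA k:{K..n}. {1..n - k + 1}) = (\<Sum>j\<le>n - K. j + 1)" .
  moreover have "2 * (\<Sum>j\<le>N. j + 1) = (N + 1) * (N + 2)" for N :: nat
    by (induction N) auto
  ultimately show ?thesis by metis
qed

lemma phi_le:
  assumes "\<pi> \<in> perms n"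
  shows "2 * phi n \<pi> \<le> n * (n + 1)"
\<comment> \<open>The window count is used with \<open>K = 1\<close>, which needs
  \<open>1 \<le> n\<close>.\<close>
proof (cases "n = 0")
  case True
  then have "phi n \<pi> = card ({} :: (nat \<times> (nat \<Rightarrow> nat)) set)"
    unfolding phi_def by (intro arg_cong[of _ _ card]) auto
  with True show ?thesis by simp
next
  case False
  have "inj \<pi>" using assms by (auto simp: perms_def intro: permutes_inj)
  then have "phi n \<pi> \<le> card (SIGMA k:{1..n}. {1..n - k + 1})"
    by (simp only: phi_eq_card_window_patterns) (rule card_image_le, simp)
  then have "2 * phi n \<pi> \<le> 2 * card (SIGMA k:{1..n}. {1..n - k + 1})" by simp
  also have "\<dots> = n * (n + 1)" using card_windows[of 1 n] False by simp
  finally show ?thesis .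
qed

text \<open>Windows of equal length at least \<open>K\<close> have distinct patterns, since a
  coincidence would restrict to their initial segments of length \<open>K\<close>. Hence
  \<open>phi\<close> is at least the number of windows of length \<open>K\<close> or more.\<close>

lemma phi_ge_if_not_repetitive:
  assumes \<pi>: "\<pi> \<in> perms n" "\<pi> \<notin> repetitive_perms n K" and K: "1 \<le> K" "K \<le> n"
  shows "(n - K)\<^sup>2 \<le> 2 * phi n \<pi>"
proof -
  let ?F = "\<lambda>(k, m). (k, window_pattern \<pi> k m)"
  let ?W = "SIGMA k:{K..n}. {1..n - k + 1}"
  have inj\<pi>: "inj \<pi>" using \<pi> by (auto simp: perms_def intro: permutes_inj)
  have agree: "windows_agree \<pi> k m m'" if "window_pattern \<pi> k m = window_pattern \<pi> k m'" for k m m'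
    using window_pattern(2)[OF inj\<pi>, where k = k and m = m]
      window_pattern(2)[OF inj\<pi>, where k = k and m = m'] that
    unfolding windows_agree_def same_relative_order_window_iff by simp
  have no: False if "windows_agree \<pi> k m m'" "K \<le> k" "k \<le> n" "1 \<le> m" "m' \<le> n - k + 1" "m < m'"
    for k m m'
  proof -
    have "windows_agree \<pi> K m m'" using that windows_agree_mono by blast
    then show False using \<pi> that by (auto simp: repetitive_perms_def)
  qed
  have "inj_on ?F ?W"
  proof (rule inj_onI, clarsimp)
    fix k m m'
    assume a: "K \<le> k" "k \<le> n" "Suc 0 \<le> m" "m \<le> Suc (n - k)" "Suc 0 \<le> m'" "m' \<le> Suc (n - k)"
      and eq: "window_pattern \<pi> k m = window_pattern \<pi> k m'"
    then show "m = m'"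
      using no[OF agree[OF eq]] no[OF agree[OF eq[symmetric]]]
      by (cases m m' rule: linorder_cases) auto
  qed
  then have "card ?W = card (?F ` ?W)" by (simp add: card_image)
  also have "\<dots> \<le> phi n \<pi>"
    unfolding phi_eq_card_window_patterns[OF inj\<pi>]
    by (intro card_mono image_mono Sigma_mono) (use K in auto)
  finally have "(n - K + 1) * (n - K + 2) \<le> 2 * phi n \<pi>" using card_windows[OF K(2)] by linarith
  moreover have "(n - K)\<^sup>2 \<le> (n - K + 1) * (n - K + 2)"
    unfolding power2_eq_square by (intro mult_mono) auto
  ultimately show ?thesis by linarith
qed

section \<open>Bounds on the expectation\<close>

lemma expected_phi_eq: "expected_phi n = (\<Sum>\<pi>\<in>perms n. real (phi n \<pi>)) / fact n"
proof -
  have "perms n \<noteq> {}" using id_in_perms by blast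
  then show ?thesis
    by (simp add: expected_phi_def integral_pmf_of_set card_perms)
qed

lemma phi_le_max_phi: "\<pi> \<in> perms n \<Longrightarrow> phi n \<pi> \<le> max_phi n"
  by (simp add: max_phi_def)

lemma max_phi_le: "2 * real (max_phi n) \<le> real n * (real n + 1)"
proof -
  have "max_phi n \<in> phi n ` perms n"
    unfolding max_phi_def by (rule Max_in) (use id_in_perms in auto)
  then have "2 * max_phi n \<le> n * (n + 1)" using phi_le by auto
  then have "real (2 * max_phi n) \<le> real (n * (n + 1))" by (rule of_nat_mono)
  then show ?thesis by (simp add: algebra_simps)
qed

lemma expected_phi_le_max_phi: "expected_phi n \<le> real (max_phi n)"
proof -
  have "(\<Sum>\<pi>\<in>perms n. real (phi n \<pi>)) \<le> (\<Sum>\<pi>\<in>perms n. real (max_phi n))"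
    by (intro sum_mono) (simp add: phi_le_max_phi)
  also have "\<dots> = fact n * real (max_phi n)" by (simp add: card_perms)
  finally show ?thesis by (simp add: expected_phi_eq divide_le_eq mult.commute)
qed

text \<open>Non-repetitive permutations contribute at least \<open>(n - s * s)\<^sup>2 / 2\<close>
  each, the others at least 0, and the proportion of the latter is at most
  \<open>2 * n\<^sup>2 / fact s\<close>.\<close>

lemma expected_phi_ge:
  assumes "1 \<le> s" "s * s \<le> n"
  shows "2 * expected_phi n \<ge> (1 - 2 * (real n)\<^sup>2 / fact s) * (real n - real (s * s))\<^sup>2"
proof -
  let ?B = "repetitive_perms n (s * s)" and ?c = "(real n - real (s * s))\<^sup>2"
  have B: "?B \<subseteq> perms n" by (auto simp: repetitive_perms_def)
  have cge: "?c \<le> 2 * real (phi n \<pi>)" if "\<pi> \<in> perms n - ?B" for \<pi>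
  proof -
    have "(n - s * s)\<^sup>2 \<le> 2 * phi n \<pi>"
      using that assms by (intro phi_ge_if_not_repetitive) auto
    then have "real ((n - s * s)\<^sup>2) \<le> real (2 * phi n \<pi>)" by (rule of_nat_mono)
    then show ?thesis using assms(2) by (simp add: of_nat_diff)
  qed
  have "real (card ?B * fact s) \<le> real (n * n * (2 * fact n))"
    using card_repetitive_perms_le[OF assms(1)] by (rule of_nat_mono)
  then have cB: "real (card ?B) \<le> fact n * (2 * (real n)\<^sup>2 / fact s)"
    by (simp add: field_simps power2_eq_square)
  \<comment> \<open>Both sides are multiplied by \<open>fact n\<close>, which turns proportions into
    numbers of permutations.\<close>
  have "fact n * ((1 - 2 * (real n)\<^sup>2 / fact s) * ?c) =
      (fact n - fact n * (2 * (real n)\<^sup>2 / fact s)) * ?c" by (simp add: algebra_simps)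
  also have "\<dots> \<le> (fact n - real (card ?B)) * ?c"
    using cB by (intro mult_right_mono) auto
  also have "fact n - real (card ?B) = real (card (perms n - ?B))"
    using B card_mono[OF finite_perms B]
    by (simp add: card_Diff_subset finite_subset[OF B] card_perms of_nat_diff)
  also have "\<dots> * ?c = (\<Sum>\<pi>\<in>perms n - ?B. ?c)" by simp
  also have "\<dots> \<le> (\<Sum>\<pi>\<in>perms n - ?B. 2 * real (phi n \<pi>))" using cge by (rule sum_mono)
  also have "\<dots> \<le> (\<Sum>\<pi>\<in>perms n. 2 * real (phi n \<pi>))" by (rule sum_mono2) auto
  also have "\<dots> = fact n * (2 * expected_phi n)"
    by (simp add: expected_phi_eq sum_distrib_left[symmetric])
  finally show ?thesis by simp
qed

section \<open>Asymptotics\<close>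

text \<open>The quotient splits into \<open>(s + 1) ^ 8 / 2 ^ s\<close> and a term of the
  exponential series at 2. The exponent 8 arises from \<open>n\<^sup>2\<close> when \<open>n\<close>
  is at most \<open>(s + 1) ^ 4\<close>.\<close>

lemma power_over_fact_tendsto_0: "(\<lambda>s. real (s + 1) ^ 8 / fact s) \<longlonglongrightarrow> 0"
proof -
  have "(\<lambda>s. inverse (fact s) * (2::real) ^ s) \<longlonglongrightarrow> 0"
    by (rule summable_LIMSEQ_zero[OF summable_exp])
  moreover have "(\<lambda>s. real (s + 1) ^ 8 / 2 ^ s) \<longlonglongrightarrow> 0" by real_asymp
  ultimately have "(\<lambda>s. (real (s + 1) ^ 8 / 2 ^ s) * (inverse (fact s) * (2::real) ^ s)) \<longlonglongrightarrow> 0"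
    using tendsto_mult by fastforce
  then show ?thesis by (simp add: field_simps)
qed

lemma expected_phi_asymptotic_bound:
  obtains b where "b \<longlonglongrightarrow> 1" "\<forall>\<^sub>F n in sequentially. b n \<le> expected_phi n / ((real n)\<^sup>2 / 2)"
proof
  \<comment> \<open>The fourth root balances two demands: \<open>s n * s n\<close> is at most the
    square root of \<open>n\<close>, hence negligible against \<open>n\<close>, while
    \<open>fact (s n)\<close> still outgrows \<open>n\<^sup>2\<close>.\<close>
  define s where "s n = nat \<lfloor>real n powr (1 / 4)\<rfloor>" for n
  define b where "b n = (1 - 2 * (real n)\<^sup>2 / fact (s n)) * (1 - real (s n * s n) / real n)\<^sup>2" for n
  have s_le: "real (s n) \<le> real n powr (1 / 4)" for n by (simp add: s_def)
  have s_ge: "real n powr (1 / 4) \<le> real (s n + 1)" for n unfolding s_def by linarith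
  have s_top: "filterlim s at_top sequentially" unfolding s_def by real_asymp
  have sq: "real (s n * s n) \<le> real n powr (1 / 2)" for n
    using mult_mono[OF s_le s_le, of n n] by (simp add: powr_add[symmetric])
  have "(\<lambda>n. real (s n * s n) / real n) \<longlonglongrightarrow> 0"
  proof (rule tendsto_sandwich[OF _ _ tendsto_const])
    show "\<forall>\<^sub>F n in sequentially. real (s n * s n) / real n \<le> real n powr (1 / 2) / real n"
      using sq by (intro always_eventually allI divide_right_mono) auto
    show "(\<lambda>n. real n powr (1 / 2) / real n) \<longlonglongrightarrow> 0" by real_asymp
  qed simp
  moreover have "(\<lambda>n. 2 * (real n)\<^sup>2 / fact (s n)) \<longlonglongrightarrow> 0"
  proof (rule tendsto_sandwich[OF _ _ tendsto_const])
    have "(\<lambda>n. real (s n + 1) ^ 8 / fact (s n)) \<longlonglongrightarrow> 0"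
      using filterlim_compose[OF power_over_fact_tendsto_0 s_top] .
    then show "(\<lambda>n. 2 * (real (s n + 1) ^ 8 / fact (s n))) \<longlonglongrightarrow> 0"
      using tendsto_mult_right_zero by blast
    show "\<forall>\<^sub>F n in sequentially. 2 * (real n)\<^sup>2 / fact (s n) \<le> 2 * (real (s n + 1) ^ 8 / fact (s n))"
    proof (rule eventually_mono[OF eventually_gt_at_top[of 0]])
      fix n :: nat assume "0 < n"
      then have "(real n)\<^sup>2 = (real n powr (1 / 4)) ^ 8"
        by (simp add: powr_power)
      also have "\<dots> \<le> real (s n + 1) ^ 8" by (rule power_mono[OF s_ge]) simp
      finally show "2 * (real n)\<^sup>2 / fact (s n) \<le> 2 * (real (s n + 1) ^ 8 / fact (s n))"
        by (simp add: divide_right_mono)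
    qed
  qed simp
  ultimately have "b \<longlonglongrightarrow> (1 - 0) * (1 - 0)\<^sup>2"
    unfolding b_def by (intro tendsto_intros)
  then show "b \<longlonglongrightarrow> 1" by simp
  show "\<forall>\<^sub>F n in sequentially. b n \<le> expected_phi n / ((real n)\<^sup>2 / 2)"
    using eventually_gt_at_top[of 0] filterlim_at_top[THEN iffD1, OF s_top, rule_format, of 1]
  proof eventually_elim
    case (elim n)
    have "real n powr (1 / 2) \<le> real n powr 1" using elim by (intro powr_mono) auto
    with sq[of n] elim have "real (s n * s n) \<le> real n" by simp
    then have "s n * s n \<le> n" by (rule of_nat_le_iff[THEN iffD1])
    from expected_phi_ge[OF elim(2) this]
    have "(1 - 2 * (real n)\<^sup>2 / fact (s n)) * (real n - real (s n * s n))\<^sup>2 / (real n)\<^sup>2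
        \<le> 2 * expected_phi n / (real n)\<^sup>2" by (rule divide_right_mono) simp
    moreover have "b n = (1 - 2 * (real n)\<^sup>2 / fact (s n)) * (real n - real (s n * s n))\<^sup>2 / (real n)\<^sup>2"
    proof -
      have "1 - real (s n * s n) / real n = (real n - real (s n * s n)) / real n"
        using elim by (simp add: diff_divide_distrib)
      then show ?thesis unfolding b_def by (simp add: power_divide)
    qed
    ultimately show ?case by (simp add: mult.commute)
  qed
qed

theorem mainTheorem1:
  shows "((\<lambda>n. expected_phi n / real (max_phi n)) \<longlonglongrightarrow> 1) \<and>
         ((\<lambda>n. expected_phi n / ((real n)\<^sup>2 / 2)) \<longlonglongrightarrow> 1)"
proof -
  obtain b where b: "b \<longlonglongrightarrow> 1" "\<forall>\<^sub>F n in sequentially. b n \<le> expected_phi n / ((real n)\<^sup>2 / 2)"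
    by (rule expected_phi_asymptotic_bound)
  \<comment> \<open>The mean is at most the maximum, which is at most
    \<open>n * (n + 1) / 2\<close>.\<close>
  have up: "expected_phi n / ((real n)\<^sup>2 / 2) \<le> (real n + 1) / real n" if "0 < n" for n
    using order_trans[OF expected_phi_le_max_phi[of n], of "real n * (real n + 1) / 2"]
      max_phi_le[of n] that
    by (simp add: field_simps power2_eq_square)
  have lim2: "(\<lambda>n. expected_phi n / ((real n)\<^sup>2 / 2)) \<longlonglongrightarrow> 1"
  proof (rule tendsto_sandwich[OF b(2) _ b(1)])
    show "\<forall>\<^sub>F n in sequentially. expected_phi n / ((real n)\<^sup>2 / 2) \<le> (real n + 1) / real n"
      using eventually_gt_at_top[of 0] by (rule eventually_mono) (rule up)
    show "(\<lambda>n. (real n + 1) / real n) \<longlonglongrightarrow> 1" by real_asymp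
  qed
  have "(\<lambda>n. expected_phi n / real (max_phi n)) \<longlonglongrightarrow> 1"
  proof (rule tendsto_sandwich[OF _ _ _ tendsto_const])
    \<comment> \<open>This holds even at \<open>n = 0\<close>, where the maximum is 0 and division
      by zero yields 0.\<close>
    show "\<forall>\<^sub>F n in sequentially. expected_phi n / real (max_phi n) \<le> 1"
      using expected_phi_le_max_phi by (intro always_eventually allI) (auto simp: divide_le_eq_1)
    \<comment> \<open>This factor changes the denominator from \<open>n\<^sup>2 / 2\<close> to
      \<open>n * (n + 1) / 2\<close>, the upper bound for \<open>max_phi n\<close>.\<close>
    have "(\<lambda>n. real n / (real n + 1)) \<longlonglongrightarrow> 1" by real_asymp
    from tendsto_mult[OF lim2 this]
    show "(\<lambda>n. expected_phi n / ((real n)\<^sup>2 / 2) * (real n / (real n + 1))) \<longlonglongrightarrow> 1" by simp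
    show "\<forall>\<^sub>F n in sequentially.
        expected_phi n / ((real n)\<^sup>2 / 2) * (real n / (real n + 1)) \<le> expected_phi n / real (max_phi n)"
      \<comment> \<open>The limit 1 makes the expectation eventually positive, hence also the
        maximum, so the two fractions can be compared through their denominators.\<close>
      using eventually_gt_at_top[of 0] order_tendstoD(1)[OF lim2 zero_less_one]
    proof eventually_elim
      case (elim n)
      then have pos: "0 < expected_phi n" by (simp add: zero_less_divide_iff)
      with expected_phi_le_max_phi[of n] have "0 < real (max_phi n)" by linarith
      moreover have "expected_phi n / ((real n)\<^sup>2 / 2) * (real n / (real n + 1)) =
          expected_phi n / (real n * (real n + 1) / 2)"
        using elim by (simp add: power2_eq_square)
      moreover have "expected_phi n / (real n * (real n + 1) / 2) \<le> expected_phi n / real (max_phi n)"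
        by (rule frac_le) (use max_phi_le[of n] pos \<open>0 < real (max_phi n)\<close> in auto)
      ultimately show ?case by simp
    qed
  qed
  with lim2 show ?thesis by simp
qed

end
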